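(* For a positive integer $n \equiv 0 \pmod 4$, let $F_1, F_2, F_3$ be graphs on a common set of $n$ vertices, each of which is isomorphic to the vertex-disjoint union of $n/4$ copies of the $4$-cycle $C_4$. Then $\gamma_{\rm sd}(F_1,F_2,F_3) \le 3n/4$.
   Context: All graphs are finite and simple. Given graphs $F_1,F_2,F_3$ (called factors; not necessarily edge-disjoint) with common vertex set $V$, a set $S \subseteq V$ is a simultaneous dominating set if for every $i \in \{1,2,3\}$ every vertex not in $S$ is adjacent in $F_i$ to some vertex of $S$. The simultaneous domination number $\gamma_{\rm sd}(F_1,F_2,F_3)$ is the minimum cardinality of a simultaneous dominating set. *)

theory Defs
  imports Complex_Main "Graph_Theory.Pair_Digraph" "Graph_Theory.Digraph_Isomorphism"
begin

text \<open>Finite simple graphs are represented by the locale \<^locale>\<open>pair_graph\<close>: finite,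
  loop-free, symmetric arc relations. The relation written with an arrow below is adjacency.\<close>

definition simultaneous_dominating_set ::
    "'a set \<Rightarrow> 'a pair_pre_digraph \<Rightarrow> 'a pair_pre_digraph \<Rightarrow> 'a pair_pre_digraph
      \<Rightarrow> 'a set \<Rightarrow> bool" where
  "simultaneous_dominating_set V F1 F2 F3 S \<longleftrightarrow>
     S \<subseteq> V \<and> (\<forall>F \<in> {F1, F2, F3}. \<forall>v \<in> V - S. \<exists>u \<in> S. v \<rightarrow>\<^bsub>with_proj F\<^esub> u)"

definition gamma_sd ::
    "'a set \<Rightarrow> 'a pair_pre_digraph \<Rightarrow> 'a pair_pre_digraph \<Rightarrow> 'a pair_pre_digraph \<Rightarrow> nat" where
  "gamma_sd V F1 F2 F3 = (LEAST k. \<exists>S. simultaneous_dominating_set V F1 F2 F3 S \<and> card S = k)"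

definition cycle4 :: "nat pair_pre_digraph" where
  "cycle4 = \<lparr> pverts = {..<4},
     parcs = {(i, j). i < 4 \<and> j < 4 \<and> (j = (i + 1) mod 4 \<or> i = (j + 1) mod 4)} \<rparr>"

definition disjoint_copies :: "nat \<Rightarrow> 'a pair_pre_digraph \<Rightarrow> (nat \<times> 'a) pair_pre_digraph" where
  "disjoint_copies k G = \<lparr> pverts = {..<k} \<times> pverts G,
     parcs = {((c, u), (c, v)) | c u v. c < k \<and> (u, v) \<in> parcs G} \<rparr>"

lemma simultaneous_dominating_set_self: "simultaneous_dominating_set V F1 F2 F3 V"
  by (simp add: simultaneous_dominating_set_def)

text \<open>The vertex set itself qualifies, so the minimum in \<^const>\<open>gamma_sd\<close> is attained.\<close>

lemma gamma_sd_attained: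
  "\<exists>S. simultaneous_dominating_set V F1 F2 F3 S \<and> card S = gamma_sd V F1 F2 F3"
  unfolding gamma_sd_def
  by (rule LeastI_ex) (use simultaneous_dominating_set_self in blast)

lemma gamma_sd_le:
  "simultaneous_dominating_set V F1 F2 F3 S \<Longrightarrow> gamma_sd V F1 F2 F3 \<le> card S"
  unfolding gamma_sd_def by (rule Least_le) blast

lemma pair_graph_cycle4: "pair_graph cycle4"
proof -
  have "parcs cycle4 \<subseteq> {..<4} \<times> {..<4}"
    by (auto simp: cycle4_def)
  then have "finite (parcs cycle4)"
    by (rule finite_subset) simp
  moreover have "(i + 1) mod 4 \<noteq> i" for i :: nat
    by presburger
  ultimately show ?thesis
    by unfold_locales (auto simp: cycle4_def symmetric_def sym_def, metis+)
qed

lemma pair_graph_disjoint_copies: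
  assumes "pair_graph G"
  shows "pair_graph (disjoint_copies k G)"
proof -
  interpret pair_graph G by fact
  have "parcs (disjoint_copies k G) \<subseteq> ({..<k} \<times> pverts G) \<times> ({..<k} \<times> pverts G)"
    by (auto simp: disjoint_copies_def dest: wellformed')
  then have "finite (parcs (disjoint_copies k G))"
    by (rule finite_subset) (simp add: pair_finite_verts)
  then show ?thesis
    by unfold_locales
      (auto simp: disjoint_copies_def symmetric_def pair_finite_verts
        intro!: symI dest: wellformed' arcs_symmetric no_loops')
qed

end

theory Submission
  imports Defs
begin

text \<open>A set \<open>V - D\<close> is simultaneously dominating as soon as \<open>D\<close> meets every 4-cycle of every factor
  in at most two vertices, since a vertex of a 4-cycle and its two neighbours are three vertices.
  Take \<open>D\<close> of maximum cardinality with this property. By maximality every vertex outside \<open>D\<close> lies in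
  some factor on a 4-cycle with two vertices in \<open>D\<close> and two outside; so each factor accounts
  for at most \<open>card D\<close> outside vertices, whence \<open>n - card D \<le> 3 * card D\<close>.\<close>

text \<open>Call a block (a fibre of \<open>b\<close>) saturated if at least \<open>r\<close> of its
  at most \<open>2 * r\<close> vertices lie in \<open>D\<close>. Then at most \<open>r\<close> lie
  outside, so within a saturated block the outside vertices never outnumber those of
  \<open>D\<close>; summing over the disjoint blocks preserves this.\<close>

lemma card_saturated_le:
  fixes b :: "'a \<Rightarrow> 'b"
  assumes "finite V" and "D \<subseteq> V" and block: "\<And>c. card {v \<in> V. b v = c} \<le> 2 * r"
  shows "card {w \<in> V - D. r \<le> card {v \<in> D. b v = b w}} \<le> card D"
proof -
  define W where "W = {w \<in> V - D. r \<le> card {v \<in> D. b v = b w}}"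
  have fin: "finite D" "finite W"
    using assms(1,2) by (auto simp: W_def finite_subset)
  have "W \<inter> D = {}"
    by (auto simp: W_def)
  have le: "card {w \<in> W. b w = c} \<le> card {v \<in> D. b v = c}" if "c \<in> b ` W" for c
  proof -
    have "card {w \<in> W. b w = c} + card {v \<in> D. b v = c}
        = card ({w \<in> W. b w = c} \<union> {v \<in> D. b v = c})"
      using fin \<open>W \<inter> D = {}\<close> by (intro card_Un_disjoint[symmetric]) auto
    also have "\<dots> \<le> card {v \<in> V. b v = c}"
      using assms(1,2) by (intro card_mono) (auto simp: W_def)
    also have "\<dots> \<le> 2 * r"
      by (rule block)
    \<comment> \<open>Since \<open>c\<close> is the label of some vertex of \<open>W\<close>, the
      part of \<open>D\<close> in this block has at least \<open>r\<close> elements, leaving at most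
      \<open>r\<close> for \<open>W\<close>.\<close>
    finally show ?thesis
      using that by (auto simp: W_def)
  qed
  have "card W = (\<Sum>c\<in>b ` W. card {w \<in> W. b w = c})"
    using sum.image_gen[OF fin(2), of "\<lambda>_. 1::nat" b] by simp
  also have "\<dots> \<le> (\<Sum>c\<in>b ` W. card {v \<in> D. b v = c})"
    by (rule sum_mono) (rule le)
  also have "\<dots> = card (\<Union>c\<in>b ` W. {v \<in> D. b v = c})"
    using fin by (intro card_UN_disjoint[symmetric]) auto
  also have "\<dots> \<le> card D"
    using fin by (intro card_mono) auto
  finally show ?thesis
    by (simp add: W_def)
qed

text \<open>For a largest admissible \<open>D\<close>, each outside vertex lies in a saturated block
  of some labelling \<open>b i\<close>. Hence \<open>card I\<close> sets, each of size at most
  \<open>card D\<close>, cover \<open>V - D\<close>.\<close>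

lemma ex_large_set_meeting_blocks_in_half:
  fixes b :: "'i \<Rightarrow> 'a \<Rightarrow> 'b"
  assumes "finite V" and "finite I"
    and block: "\<And>i c. i \<in> I \<Longrightarrow> card {v \<in> V. b i v = c} \<le> 2 * r"
  shows "\<exists>D\<subseteq>V. (\<forall>i\<in>I. \<forall>c. card {v \<in> D. b i v = c} \<le> r) \<and> card V \<le> (card I + 1) * card D"
proof -
  define good where "good D \<longleftrightarrow> D \<subseteq> V \<and> (\<forall>i\<in>I. \<forall>c. card {v \<in> D. b i v = c} \<le> r)" for D
  have "good {}"
    by (simp add: good_def)
  moreover have "\<forall>D. good D \<longrightarrow> card D < card V + 1"
    using card_mono[OF assms(1)] by (auto simp: good_def less_Suc_eq_le)
  ultimately obtain D where D: "good D" and max: "\<And>D'. good D' \<Longrightarrow> card D' \<le> card D"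
    using ex_has_greatest_nat[of good "{}" card] by blast
  define W where "W i = {w \<in> V - D. r \<le> card {v \<in> D. b i v = b i w}}" for i
  have DV: "D \<subseteq> V" and "finite D"
    using D assms(1) by (auto simp: good_def finite_subset)
  have "V - D \<subseteq> (\<Union>i\<in>I. W i)"
  proof
    fix w assume w: "w \<in> V - D"
    then have "\<not> good (insert w D)"
      using max[of "insert w D"] \<open>finite D\<close> by auto
    then obtain i c where i: "i \<in> I" and c: "r < card {v \<in> insert w D. b i v = c}"
      using w DV by (auto simp: good_def not_le)
    have small: "card {v \<in> D. b i v = c} \<le> r"
      using D i by (auto simp: good_def)
    \<comment> \<open>Inserting \<open>w\<close> enlarges only its own block, so the overfull block
      must be that one, and it already had \<open>r\<close> elements in \<open>D\<close>.\<close>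
    have ins: "{v \<in> insert w D. b i v = c} =
        (if b i w = c then insert w {v \<in> D. b i v = c} else {v \<in> D. b i v = c})"
      by auto
    have "b i w = c"
      using c small unfolding ins by (auto split: if_splits)
    moreover from this have "r \<le> card {v \<in> D. b i v = c}"
      using c w \<open>finite D\<close> unfolding ins by simp
    ultimately show "w \<in> (\<Union>i\<in>I. W i)"
      using i w by (auto simp: W_def)
  qed
  then have "card (V - D) \<le> card (\<Union>i\<in>I. W i)"
    using assms(1,2) by (intro card_mono) (auto simp: W_def)
  also have "\<dots> \<le> (\<Sum>i\<in>I. card (W i))"
    by (rule card_UN_le) fact
  also have "\<dots> \<le> (\<Sum>i\<in>I. card D)"
    unfolding W_def by (intro sum_mono card_saturated_le assms(1) DV block)
  finally have "card V \<le> (card I + 1) * card D"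
    using DV \<open>finite D\<close> by (simp add: card_Diff_subset)
  then show ?thesis
    using D by (auto simp: good_def)
qed

text \<open>The interface between the factors and the counting argument: the fibres of
  \<open>b\<close> stand for the 4-cycles. A labelling makes the blocks disjoint
  automatically.\<close>

definition domination_blocks :: "'a pair_pre_digraph \<Rightarrow> ('a \<Rightarrow> 'b) \<Rightarrow> bool" where
  "domination_blocks F b \<longleftrightarrow>
     (\<forall>c. card {v \<in> pverts F. b v = c} \<le> 4) \<and>
     (\<forall>D v. D \<subseteq> pverts F \<longrightarrow> (\<forall>c. card {u \<in> D. b u = c} \<le> 2) \<longrightarrow> v \<in> D \<longrightarrow>
       (\<exists>u \<in> pverts F - D. v \<rightarrow>\<^bsub>with_proj F\<^esub> u))"

text \<open>Each vertex is labelled with the index of the copy of \<open>cycle4\<close> containing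
  its image. If a vertex of \<open>D\<close> had both neighbours in \<open>D\<close>, its block
  would contain three elements of \<open>D\<close>.\<close>

lemma ex_domination_blocks_cycle4_copies:
  fixes F :: "'a pair_pre_digraph"
  assumes "digraph_iso (with_proj F) (with_proj (disjoint_copies k cycle4))"
  shows "\<exists>b :: 'a \<Rightarrow> nat. domination_blocks F b"
proof -
  from assms obtain h where h: "pre_digraph.digraph_isomorphism (with_proj F) h"
    and eq: "with_proj (disjoint_copies k cycle4) = app_iso h (with_proj F)"
    by (auto simp: digraph_iso_def)
  define f where "f = iso_verts h"
  interpret wf_digraph "with_proj F"
    using h by (simp add: pre_digraph.digraph_isomorphism_def)
  have inj: "inj_on f (pverts F)"
    using digraph_isomorphism_inj_on_verts[OF h] by (simp add: f_def)
  have img: "f ` pverts F = {..<k} \<times> {..<4}"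
    using arg_cong[OF eq, of verts] by (simp add: f_def disjoint_copies_def cycle4_def)
  have arcs: "parcs (disjoint_copies k cycle4) = (\<lambda>(u, v). (f u, f v)) ` parcs F"
    using arg_cong[OF eq, of arcs_ends] arcs_ends_app_iso_eq[OF h] by (simp add: f_def)
  \<comment> \<open>The arcs of the copies are known only as an image of \<open>parcs F\<close>;
    injectivity of \<open>f\<close> on the vertices pulls an arc back.\<close>
  have arc: "(u, v) \<in> parcs F"
    if uv: "u \<in> pverts F" "v \<in> pverts F" "(f u, f v) \<in> parcs (disjoint_copies k cycle4)" for u v
  proof -
    from uv(3) obtain u' v' where *: "(u', v') \<in> parcs F" "f u' = f u" "f v' = f v"
      unfolding arcs by auto
    then have "u' \<in> pverts F" "v' \<in> pverts F"
      using tail_in_verts[of "(u', v')"] head_in_verts[of "(u', v')"] by auto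
    with * uv(1,2) inj show ?thesis
      by (metis inj_onD)
  qed
  have "card {v \<in> pverts F. fst (f v) = c} \<le> 4" for c
  proof -
    have "card {v \<in> pverts F. fst (f v) = c} \<le> card ({c} \<times> {..<4::nat})"
    proof (rule card_inj_on_le)
      show "inj_on f {v \<in> pverts F. fst (f v) = c}"
        using inj by (rule inj_on_subset) auto
      show "f ` {v \<in> pverts F. fst (f v) = c} \<subseteq> {c} \<times> {..<4}"
      proof
        fix z assume "z \<in> f ` {v \<in> pverts F. fst (f v) = c}"
        then have "fst z = c" "z \<in> f ` pverts F"
          by auto
        then show "z \<in> {c} \<times> {..<4}"
          unfolding img by auto
      qed
    qed simp
    then show ?thesis by simp
  qed
  moreover have "\<exists>u \<in> pverts F - D. v \<rightarrow>\<^bsub>with_proj F\<^esub> u"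
    if D: "D \<subseteq> pverts F" and few: "\<And>c. card {u \<in> D. fst (f u) = c} \<le> 2" and v: "v \<in> D" for D v
  proof (rule ccontr)
    assume no: "\<not> ?thesis"
    obtain c i where fv: "f v = (c, i)"
      by force
    then have ci: "c < k" "i < 4"
      using imageI[of v "pverts F" f] v D unfolding img by auto
    \<comment> \<open>Successor and predecessor of \<open>i\<close> on the cycle; adding 3 modulo 4
      avoids truncated subtraction.\<close>
    define x where "x = (i + 1) mod 4"
    define y where "y = (i + 3) mod 4"
    have xy: "x < 4" "y < 4" "x \<noteq> i" "y \<noteq> i" "x \<noteq> y" "i = (y + 1) mod 4"
      using ci(2) unfolding x_def y_def by presburger+
    \<comment> \<open>By \<open>no\<close>, every neighbour of \<open>v\<close> in \<open>F\<close>
      lies in \<open>D\<close>.\<close>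
    have nbr: "\<exists>u \<in> D. f u = (c, j)" if j: "j < 4" "j = (i + 1) mod 4 \<or> i = (j + 1) mod 4" for j
    proof -
      from j ci img obtain u where u: "u \<in> pverts F" "f u = (c, j)"
        by (metis (no_types, lifting) SigmaI imageE lessThan_iff)
      have "(v, u) \<in> parcs F"
        by (rule arc) (use v D u fv j ci in \<open>auto simp: disjoint_copies_def cycle4_def\<close>)
      with no u show ?thesis by auto
    qed
    obtain p where p: "p \<in> D" "f p = (c, x)"
      using nbr[of x] xy by (auto simp: x_def)
    obtain q where q: "q \<in> D" "f q = (c, y)"
      using nbr[of y] xy by auto
    have "card {v, p, q} = 3"
      using p q fv xy by (auto simp: card_insert_if)
    moreover have "card {v, p, q} \<le> card {u \<in> D. fst (f u) = c}"
    proof (rule card_mono)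
      have "finite (pverts F)"
        using inj img by (metis finite_SigmaI finite_imageD finite_lessThan)
      then show "finite {u \<in> D. fst (f u) = c}"
        using D by (simp add: finite_subset)
    qed (use p q v fv in auto)
    ultimately show False
      using few[of c] by simp
  qed
  ultimately have "domination_blocks F (\<lambda>v. fst (f v))"
    unfolding domination_blocks_def by simp
  then show ?thesis
    by (rule exI[of _ "\<lambda>v. fst (f v)"])
qed

theorem theorem25:
  fixes V :: "'a set" and F1 F2 F3 :: "'a pair_pre_digraph" and n :: nat
  assumes "n > 0" and "n mod 4 = 0"
    and "card V = n"
    and "pair_graph F1" and "pair_graph F2" and "pair_graph F3"
    and "pverts F1 = V" and "pverts F2 = V" and "pverts F3 = V"
    and "digraph_iso (with_proj F1) (with_proj (disjoint_copies (n div 4) cycle4))"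
    and "digraph_iso (with_proj F2) (with_proj (disjoint_copies (n div 4) cycle4))"
    and "digraph_iso (with_proj F3) (with_proj (disjoint_copies (n div 4) cycle4))"
  shows "real (gamma_sd V F1 F2 F3) \<le> 3 * real n / 4"
proof -
  let ?I = "{F1, F2, F3}"
  have fin: "finite V"
    using assms(1,3) by (simp add: card_ge_0_finite)
  have verts: "pverts F = V" if "F \<in> ?I" for F
    using that assms(7-9) by auto
  have "\<forall>F\<in>?I. \<exists>b :: 'a \<Rightarrow> nat. domination_blocks F b"
    using assms(10-12)[THEN ex_domination_blocks_cycle4_copies] by simp
  from bchoice[OF this] obtain b :: "'a pair_pre_digraph \<Rightarrow> 'a \<Rightarrow> nat"
    where b: "\<forall>F\<in>?I. domination_blocks F (b F)" ..
  have block: "card {v \<in> V. b F v = c} \<le> 2 * 2" if "F \<in> ?I" for F c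
    using bspec[OF b that] verts[OF that] by (simp add: domination_blocks_def)
  have "\<exists>D\<subseteq>V. (\<forall>F\<in>?I. \<forall>c. card {v \<in> D. b F v = c} \<le> 2) \<and> card V \<le> (card ?I + 1) * card D"
    by (rule ex_large_set_meeting_blocks_in_half) (use fin block in \<open>simp_all only: finite.intros\<close>)
  then obtain D where D: "D \<subseteq> V" "\<forall>F\<in>?I. \<forall>c. card {v \<in> D. b F v = c} \<le> 2"
    and large: "card V \<le> (card ?I + 1) * card D"
    by (elim exE conjE)
  have "simultaneous_dominating_set V F1 F2 F3 (V - D)"
    unfolding simultaneous_dominating_set_def
  proof (intro conjI ballI)
    fix F v assume F: "F \<in> ?I" and v: "v \<in> V - (V - D)"
    then show "\<exists>u \<in> V - D. v \<rightarrow>\<^bsub>with_proj F\<^esub> u"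
      using bspec[OF b F] bspec[OF D(2) F] D(1) v unfolding domination_blocks_def verts[OF F]
      by simp
  qed auto
  then have "gamma_sd V F1 F2 F3 \<le> card (V - D)"
    by (rule gamma_sd_le)
  also have "card (V - D) = n - card D"
    using D(1) fin assms(3) by (simp add: card_Diff_subset finite_subset)
  finally have "gamma_sd V F1 F2 F3 \<le> n - card D" .
  \<comment> \<open>The factors may coincide, so \<open>card ?I\<close> is only bounded by 3; the
    upper bound suffices, as \<open>large\<close> has it on the right.\<close>
  moreover have "card ?I + 1 \<le> 4"
    by (simp add: card_insert_if)
  then have "n \<le> 4 * card D"
    using large assms(3) mult_le_mono1[of "card ?I + 1" 4 "card D"] by linarith
  ultimately have "4 * gamma_sd V F1 F2 F3 \<le> 3 * n"
    by linarith
  then show ?thesis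
    by linarith
qed

end
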